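(* If the network $(\alpha,\mu,P,Q)$ with $n$ nodes satisfies the overflow condition (defined in the context), then the overflow traffic equation $$\lambda=\alpha+\min(\lambda,\mu)P+\max(\lambda-\mu,0)Q$$ has a unique, nonnegative solution. Additionally, the overflow algorithm (described in the context) finds this solution in at most $n^2$ iterations. Each iteration consists of solving a linear equation in $n$ variables that has a unique solution.
   Context: Vectors are row vectors; inequalities, $\min$ and $\max$ are entrywise. Let $n\in\mathbb{N}$ and $N=\{1,\dots,n\}$. A network $(\alpha,\mu,P,Q)$ consists of a vector $\alpha\in\mathbb{R}^n$ with $\alpha\ge 0$, a vector $\mu\in\mathbb{R}^n$ with $\mu>0$ (all entries strictly positive), and substochastic $n\times n$ matrices $P=(p_{ij})$ and $Q=(q_{ij})$ (nonnegative entries, row sums at most $1$). The unknown in the overflow traffic equation is $\lambda\in\mathbb{R}^n$. Write $p_{ij}^k$ for the $(i,j)$ entry of $P^k$, and $\sigma(M)$ for the spectral radius of a matrix $M$. For an $n\times n$ matrix $M$ and $A\subset N$, $M_A$ denotes the $n\times n$ matrix obtained from $M$ by replacing all rows with index not in $A$ by zero rows. The symbol $\subset$ allows equality. Classes: $i,j\in N$ communicate if $i=j$ or if $p_{ij}^k>0$ and $p_{ji}^l>0$ for some $k,l\ge 0$; the equivalence classes are called the classes of $P$. A class $C$ can be filled if $\alpha_i>0$ for some $i\in C$, or if there are $i\in N$ with $\alpha_i>0$, $j\in C$ and $k\in\mathbb{N}$ with $p_{ij}^k>0$. A class $C$ can be drained if there is $i\in C$ with $\sum_{j=1}^n p_{ij}<1$,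 or there are $i\in C$ and $j\in N\setminus C$ with $p_{ij}>0$. A class is isolated if it can be neither filled nor drained. $(\alpha,\mu,P)$ is NI if it contains no isolated class. If $(\alpha,\mu,P)$ is NI, the equation $\lambda=\alpha+\min(\lambda,\mu)P$ has a unique, nonnegative solution, denoted $\lambda^*$. Overflow condition: $(\alpha,\mu,P)$ is NI, and $\sigma(P_A+Q_{N\setminus A})<1$ for every set $A\subset N\setminus U^*$ (including $A=\emptyset$), where $U^*=\{i\in N:\lambda_i^*\ge\mu_i\}$. Overflow algorithm: set $U^{(0)}=\emptyset$. Outer loop, for $\kappa=1,2,\dots$: set $S^{(0)}=\emptyset$ and run the inner loop: for $\ell=1,2,\dots$, solve the linear equation $$\lambda=\alpha+\mu P_{N\setminus S}+\lambda P_S+(\lambda-\mu)Q_B$$ with $S=S^{(\ell-1)}$ and $B=U^{(\kappa-1)}$ to obtain a solution denoted by $\lambda^{(\kappa,\ell)}$, and set $S^{(\ell)}=\{i\in N\setminus U^{(\kappa-1)}:\lambda_i^{(\kappa,\ell)}<\mu_i\}$; the inner loop stops at the first $\ell\ge 1$ with $S^{(\ell)}=S^{(\ell-1)}$, and then $\lambda^{(\kappa)}:=\lambda^{(\kappa,\ell)}$. Set $U^{(\kappa)}=\{i\in N:\lambda_i^{(\kappa)}\ge\mu_i\}$. The outer loop stops at the first $\kappa\ge 1$ with $U^{(\kappa)}=U^{(\kappa-1)}$, and the algorithm returns $\lambda^{(\kappa)}$. Iterations are counted as the total number of inner-loop iterations over the whole run.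
   Formalization: For n = 1 the bound n² = 1 on the number of iterations is false (every run takes exactly 2 iterations, e.g. α = 1/2, μ = 1, P = Q = 0), so the bound is stated as 2 for n = 1 and as n² for n ≥ 2. *)

theory Defs
  imports "HOL-Analysis.Analysis"
begin

definition substochastic :: "real^'n^'n \<Rightarrow> bool" where
  "substochastic M \<longleftrightarrow> (\<forall>i j. 0 \<le> M $ i $ j) \<and> (\<forall>i. (\<Sum>j\<in>UNIV. M $ i $ j) \<le> 1)"

(* The library order < on real^'n is not entrywise strict, hence the quantifier for mu. *)
definition network :: "real^'n \<Rightarrow> real^'n \<Rightarrow> real^'n^'n \<Rightarrow> real^'n^'n \<Rightarrow> bool" where
  "network \<alpha> \<mu> P Q \<longleftrightarrow>
     0 \<le> \<alpha> \<and> (\<forall>i. 0 < \<mu> $ i) \<and> substochastic P \<and> substochastic Q"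

(* The library's * and ^ on vectors are entrywise, so matrix powers need their own definition. *)
primrec mat_pow :: "real^'n^'n \<Rightarrow> nat \<Rightarrow> real^'n^'n" where
  "mat_pow M 0 = mat 1"
| "mat_pow M (Suc k) = mat_pow M k ** M"

definition restrict_rows :: "real^'n^'n \<Rightarrow> 'n set \<Rightarrow> real^'n^'n" where
  "restrict_rows M A = (\<chi> i j. if i \<in> A then M $ i $ j else 0)"

definition spectrum :: "real^'n^'n \<Rightarrow> complex set" where
  "spectrum M = {c. \<exists>v. v \<noteq> 0 \<and> map_matrix complex_of_real M *v v = c *s v}"

(* The spectrum is finite and nonempty, so this supremum is a maximum. *)
(* The spectrum is finite and nonempty, so the supremum is a maximum. *)
definition spectral_radius :: "real^'n^'n \<Rightarrow> real" where
  "spectral_radius M = Sup (cmod ` spectrum M)"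

definition communicating :: "real^'n^'n \<Rightarrow> ('n \<times> 'n) set" where
  "communicating P =
     {(i, j). i = j \<or> (\<exists>k l. 0 < mat_pow P k $ i $ j \<and> 0 < mat_pow P l $ j $ i)}"

definition classes :: "real^'n^'n \<Rightarrow> 'n set set" where
  "classes P = UNIV // communicating P"

definition can_be_filled :: "real^'n \<Rightarrow> real^'n^'n \<Rightarrow> 'n set \<Rightarrow> bool" where
  "can_be_filled \<alpha> P C \<longleftrightarrow>
     (\<exists>i\<in>C. 0 < \<alpha> $ i) \<or>
     (\<exists>i. \<exists>j\<in>C. \<exists>k\<ge>1. 0 < \<alpha> $ i \<and> 0 < mat_pow P k $ i $ j)"

definition can_be_drained :: "real^'n^'n \<Rightarrow> 'n set \<Rightarrow> bool" where
  "can_be_drained P C \<longleftrightarrow>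
     (\<exists>i\<in>C. (\<Sum>j\<in>UNIV. P $ i $ j) < 1) \<or> (\<exists>i\<in>C. \<exists>j\<in>- C. 0 < P $ i $ j)"

definition isolated_class :: "real^'n \<Rightarrow> real^'n^'n \<Rightarrow> 'n set \<Rightarrow> bool" where
  "isolated_class \<alpha> P C \<longleftrightarrow> \<not> can_be_filled \<alpha> P C \<and> \<not> can_be_drained P C"

(* The traffic equation without overflow does not involve Q; NI and lambda_star are likewise
   independent of Q, and NI does not depend on mu. *)
definition NI :: "real^'n \<Rightarrow> real^'n^'n \<Rightarrow> bool" where
  "NI \<alpha> P \<longleftrightarrow> \<not> (\<exists>C\<in>classes P. isolated_class \<alpha> P C)"

(* On real^'n, the library's inf and sup are the entrywise minimum and maximum, and v* is the
   product of a row vector with a matrix. The description operator is only used under NI, where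
   the equation has exactly one solution. *)
definition lambda_star :: "real^'n \<Rightarrow> real^'n \<Rightarrow> real^'n^'n \<Rightarrow> real^'n" where
  "lambda_star \<alpha> \<mu> P = (THE x. x = \<alpha> + inf x \<mu> v* P)"

definition overflow_set :: "real^'n \<Rightarrow> real^'n \<Rightarrow> 'n set" where
  "overflow_set \<mu> x = {i. \<mu> $ i \<le> x $ i}"

definition overflow_condition ::
    "real^'n \<Rightarrow> real^'n \<Rightarrow> real^'n^'n \<Rightarrow> real^'n^'n \<Rightarrow> bool" where
  "overflow_condition \<alpha> \<mu> P Q \<longleftrightarrow>
     NI \<alpha> P \<and>
     (\<forall>A \<subseteq> - overflow_set \<mu> (lambda_star \<alpha> \<mu> P).
        spectral_radius (restrict_rows P A + restrict_rows Q (- A)) < 1)"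

definition overflow_traffic_eq ::
    "real^'n \<Rightarrow> real^'n \<Rightarrow> real^'n^'n \<Rightarrow> real^'n^'n \<Rightarrow> real^'n \<Rightarrow> bool" where
  "overflow_traffic_eq \<alpha> \<mu> P Q x \<longleftrightarrow> x = \<alpha> + inf x \<mu> v* P + sup (x - \<mu>) 0 v* Q"

definition iteration_eq ::
    "real^'n \<Rightarrow> real^'n \<Rightarrow> real^'n^'n \<Rightarrow> real^'n^'n \<Rightarrow> 'n set \<Rightarrow> 'n set \<Rightarrow> real^'n \<Rightarrow> bool" where
  "iteration_eq \<alpha> \<mu> P Q B S x \<longleftrightarrow>
     x = \<alpha> + \<mu> v* restrict_rows P (- S) + x v* restrict_rows P S
           + (x - \<mu>) v* restrict_rows Q B"

(* Running B S: the next iteration solves the linear equation for these two sets, where B is the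
   set U computed by the previous pass of the outer loop. Returned x: the algorithm has stopped. *)
datatype 'n state = Running "'n set" "'n set" | Returned "real^'n"

(* Each transition is one inner-loop iteration, i.e. one linear solve; where the inner loop stops,
   the transition also performs the bookkeeping of the outer loop. The relation allows every
   solution of the linear equation to be picked. *)
inductive iteration ::
    "real^'n \<Rightarrow> real^'n \<Rightarrow> real^'n^'n \<Rightarrow> real^'n^'n \<Rightarrow> 'n state \<Rightarrow> 'n state \<Rightarrow> bool"
  for \<alpha> \<mu> P Q where
  inner_continue:
    "\<lbrakk>iteration_eq \<alpha> \<mu> P Q B S x; S' = {i. i \<notin> B \<and> x $ i < \<mu> $ i}; S' \<noteq> S\<rbrakk>
     \<Longrightarrow> iteration \<alpha> \<mu> P Q (Running B S) (Running B S')"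
| outer_continue:
    "\<lbrakk>iteration_eq \<alpha> \<mu> P Q B S x; {i. i \<notin> B \<and> x $ i < \<mu> $ i} = S; overflow_set \<mu> x \<noteq> B\<rbrakk>
     \<Longrightarrow> iteration \<alpha> \<mu> P Q (Running B S) (Running (overflow_set \<mu> x) {})"
| outer_stop:
    "\<lbrakk>iteration_eq \<alpha> \<mu> P Q B S x; {i. i \<notin> B \<and> x $ i < \<mu> $ i} = S; overflow_set \<mu> x = B\<rbrakk>
     \<Longrightarrow> iteration \<alpha> \<mu> P Q (Running B S) (Returned x)"

(* With a single node, every run has exactly two transitions: from Running {} {} it passes through
   Running {} UNIV or Running UNIV {} before it stops. The bound n^2 therefore requires n >= 2. *)
abbreviation initial_state :: "'n::finite state" where
  "initial_state \<equiv> Running {} {}"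

end

theory Submission
  imports Defs
begin

text \<open>
  Everything rests on counting mass. Multiplying a nonnegative row vector by a substochastic matrix
  cannot increase the sum of its entries. So if a nonnegative vector \<open>d\<close> is bounded by flows
  \<open>a v* P + b v* Q\<close> that start from at most the mass \<open>d\<close>, then no mass is lost anywhere: all
  inequalities are equalities, and the rows that carry mass are stochastic and never leave the
  support of \<open>d\<close> (\<open>mass_balance\<close>).

  This turns the spectral condition into something elementary. A spectral radius below \<open>1\<close> excludes
  the eigenvalue \<open>1\<close>, so there is no nonzero row vector with \<open>x = x v* M\<close>. For a
  substochastic matrix that alone gives, by counting mass, a comparison principle for the linear
  equation \<open>x = c + x v* M\<close> (subsolutions lie below supersolutions), its unique solvability, and
  the absence of a set of nodes that keeps all its mass.

  Without overflow, the same argument compares a nonnegative solution \<open>w\<close> with a supersolution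
  \<open>z\<close>. The set where \<open>z < w\<close> is closed and stochastic, hence contains a class that cannot be
  drained; by the NI condition it can be filled, so external flow enters a set that already keeps
  all its mass, a contradiction. Together with the existence of a fixed point (Brouwer),
  \<open>\<lambda>\<^sup>*\<close> is the unique solution and lies below every supersolution, in particular below every
  solution of the overflow equation. The nodes below capacity in such a solution are therefore
  among the nodes \<open>i\<close> with \<open>\<lambda>\<^sup>*\<^sub>i < \<mu>\<^sub>i\<close>, where the overflow condition applies.

  Two solutions of the overflow equation differ by a vector \<open>d = a + b\<close>, where \<open>a\<close> is the
  difference of the served flows, routed by \<open>P\<close>, and \<open>b\<close> that of the overflows, routed by
  \<open>Q\<close>. If \<open>d\<close> is not zero, its support keeps all its mass under the matrix with
  rows of \<open>P\<close> where \<open>a\<close> is positive and rows of \<open>Q\<close> elsewhere, which the overflow condition forbids.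

  For the algorithm, the comparison principle shows that the inner loop only lowers its iterates and
  the outer loop only raises them. So \<open>S\<close> grows within a pass, \<open>B\<close> grows from pass to pass, and
  all matrices that occur are dominated by matrices of the overflow condition. A pass that ends with
  \<open>S = - U\<close> takes at most \<open>n - card U + 1\<close> iterations, and \<open>U\<close> grows strictly except in
  the last pass; this adds up to at most \<open>n (n + 1) / 2 + 1\<close>, which
  is \<open>2\<close> for \<open>n = 1\<close> and at most \<open>n\<^sup>2\<close> for larger \<open>n\<close>.
\<close>

section \<open>Row vectors and substochastic matrices\<close>

lemma vec_le_iff: "(x::real^'n) \<le> y \<longleftrightarrow> (\<forall>i. x $ i \<le> y $ i)"
  by (simp add: less_eq_vec_def)

lemma inf_vec_nth: "inf x y $ i = min (x $ i) (y $ i :: real)"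
  by (simp add: inf_vec_def inf_real_def)

lemma sup_vec_nth: "sup x y $ i = max (x $ i) (y $ i :: real)"
  by (simp add: sup_vec_def sup_real_def)

lemma vec_mat_nth: "((x::real^'n) v* M) $ j = (\<Sum>i\<in>UNIV. x $ i * M $ i $ j)"
  by (simp add: vector_matrix_mult_def mult.commute)

lemma vec_mat_nth_restrict:
  "((x::real^'n) v* restrict_rows M A) $ j = (\<Sum>i\<in>A. x $ i * M $ i $ j)"
proof -
  have "(\<Sum>i\<in>UNIV. x $ i * restrict_rows M A $ i $ j) = (\<Sum>i\<in>UNIV. if i \<in> A then x $ i * M $ i $ j else 0)"
    by (intro sum.cong) (auto simp: restrict_rows_def)
  then show ?thesis by (simp add: vec_mat_nth sum.If_cases)
qed

lemma vec_mat_mono: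
  assumes "(x::real^'n) \<le> y" "substochastic M"
  shows "x v* M \<le> y v* M"
  using assms unfolding vec_le_iff vec_mat_nth substochastic_def
  by (intro allI sum_mono mult_right_mono) auto

lemma substochastic_mono:
  assumes "substochastic M" "\<And>i j. 0 \<le> M' $ i $ j" "\<And>i j. M' $ i $ j \<le> M $ i $ j"
  shows "substochastic M'"
proof -
  have "(\<Sum>j\<in>UNIV. M' $ i $ j) \<le> 1" for i
  proof -
    have "(\<Sum>j\<in>UNIV. M' $ i $ j) \<le> (\<Sum>j\<in>UNIV. M $ i $ j)"
      by (intro sum_mono assms)
    also have "\<dots> \<le> 1" using assms(1) by (simp add: substochastic_def)
    finally show ?thesis .
  qed
  then show ?thesis using assms(2) by (simp add: substochastic_def)
qed

lemma substochastic_row_mixture: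
  assumes "substochastic P" "substochastic Q"
  shows "substochastic (restrict_rows P A + restrict_rows Q (- A))"
  unfolding substochastic_def
proof (intro conjI allI)
  fix i
  show "0 \<le> (restrict_rows P A + restrict_rows Q (- A)) $ i $ j" for j
    using assms by (simp add: restrict_rows_def substochastic_def)
  show "(\<Sum>j\<in>UNIV. (restrict_rows P A + restrict_rows Q (- A)) $ i $ j) \<le> 1"
    using assms by (cases "i \<in> A") (simp_all add: restrict_rows_def substochastic_def)
qed

text \<open>
  Summing all entries gives
  \<open>\<Sum>d \<le> \<Sum>(a v* P + b v* Q) \<le> \<Sum>(a + b) \<le> \<Sum>d\<close>, so none of the entrywise inequalities behind this
  chain can be strict. Two matrices are needed because a node routes its served flow by \<open>P\<close> and its
  overflow by \<open>Q\<close>.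
\<close>

lemma mass_balance:
  fixes a b d :: "real^'n"
  assumes P: "substochastic P" and Q: "substochastic Q"
    and a: "0 \<le> a" and b: "0 \<le> b" and ab: "a + b \<le> d" and d: "d \<le> a v* P + b v* Q"
  shows "d = a + b" and "d = a v* P + b v* Q"
    and "0 < a $ i \<Longrightarrow> (\<Sum>j\<in>UNIV. P $ i $ j) = 1"
    and "0 < b $ i \<Longrightarrow> (\<Sum>j\<in>UNIV. Q $ i $ j) = 1"
    and "d $ j = 0 \<Longrightarrow> 0 < a $ i \<Longrightarrow> P $ i $ j = 0"
    and "d $ j = 0 \<Longrightarrow> 0 < b $ i \<Longrightarrow> Q $ i $ j = 0"
proof -
  define p q where "p i = (\<Sum>j\<in>UNIV. P $ i $ j)" and "q i = (\<Sum>j\<in>UNIV. Q $ i $ j)" for i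
  have total: "(\<Sum>j\<in>UNIV. (a v* P + b v* Q) $ j) = (\<Sum>i\<in>UNIV. a $ i * p i + b $ i * q i)"
  proof -
    have *: "(\<Sum>j\<in>UNIV. (x v* M) $ j) = (\<Sum>i\<in>UNIV. x $ i * (\<Sum>j\<in>UNIV. M $ i $ j))"
      for x :: "real^'n" and M :: "real^'n^'n"
      unfolding vec_mat_nth by (subst sum.swap) (simp add: sum_distrib_left)
    show ?thesis by (simp add: sum.distrib * p_def q_def)
  qed
  have p1: "p i \<le> 1" and q1: "q i \<le> 1" for i
    using P Q by (auto simp: substochastic_def p_def q_def)
  have a0: "0 \<le> a $ i" and b0: "0 \<le> b $ i" for i
    using a b by (auto simp: vec_le_iff)
  have ap: "a $ i * p i \<le> a $ i" and bq: "b $ i * q i \<le> b $ i" for i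
    using mult_left_mono[OF p1 a0] mult_left_mono[OF q1 b0] by simp_all
  have d1: "d $ j \<le> (a v* P + b v* Q) $ j" and d2: "(a + b) $ j \<le> d $ j" for j
    using ab d by (auto simp: vec_le_iff)
  \<comment> \<open>A sum of nonnegative slacks that vanishes in total.\<close>
  define slack where "slack i = ((a v* P + b v* Q) $ i - d $ i) + (d $ i - (a + b) $ i)
      + (a $ i - a $ i * p i) + (b $ i - b $ i * q i)" for i
  have "sum slack UNIV = 0"
    using total[unfolded vector_add_component sum.distrib]
    unfolding slack_def vector_add_component sum.distrib sum_subtractf by linarith
  moreover have "0 \<le> slack i" for i
    unfolding slack_def using d1[of i] d2[of i] ap[of i] bq[of i] by linarith
  ultimately have "slack i = 0" for i by (simp add: sum_nonneg_eq_0_iff)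
  then have eqs: "d $ i = (a v* P + b v* Q) $ i" "d $ i = (a + b) $ i"
      "a $ i = a $ i * p i" "b $ i = b $ i * q i" for i
    unfolding slack_def using d1[of i] d2[of i] ap[of i] bq[of i] by (smt (verit))+
  show "d = a + b" using eqs(2) by (simp add: vec_eq_iff)
  show deq: "d = a v* P + b v* Q" using eqs(1) by (simp add: vec_eq_iff)
  show "0 < a $ i \<Longrightarrow> (\<Sum>j\<in>UNIV. P $ i $ j) = 1" using eqs(3)[of i] by (simp add: p_def)
  show "0 < b $ i \<Longrightarrow> (\<Sum>j\<in>UNIV. Q $ i $ j) = 1" using eqs(4)[of i] by (simp add: q_def)
  have "(\<Sum>i\<in>UNIV. a $ i * P $ i $ j + b $ i * Q $ i $ j) = d $ j"
    unfolding deq by (simp add: vec_mat_nth sum.distrib)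
  moreover have ge: "0 \<le> a $ i * P $ i $ j" "0 \<le> b $ i * Q $ i $ j" for i
    using a0 b0 P Q by (simp_all add: substochastic_def)
  ultimately have "d $ j = 0 \<Longrightarrow> a $ i * P $ i $ j + b $ i * Q $ i $ j = 0" for i
    using sum_nonneg_eq_0_iff[of UNIV "\<lambda>i. a $ i * P $ i $ j + b $ i * Q $ i $ j"] by auto
  then have "d $ j = 0 \<Longrightarrow> a $ i * P $ i $ j = 0 \<and> b $ i * Q $ i $ j = 0"
    using ge by (simp add: add_nonneg_eq_0_iff)
  then show "d $ j = 0 \<Longrightarrow> 0 < a $ i \<Longrightarrow> P $ i $ j = 0"
    and "d $ j = 0 \<Longrightarrow> 0 < b $ i \<Longrightarrow> Q $ i $ j = 0" by auto
qed

section \<open>Subcritical matrices\<close>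

text \<open>
  For a substochastic matrix this is equivalent to a spectral radius below \<open>1\<close> (by
  Perron-Frobenius), but the form with left eigenvectors is what arguments about mass can use.
\<close>

definition subcritical :: "real^'n^'n \<Rightarrow> bool" where
  "subcritical M \<longleftrightarrow> substochastic M \<and> (\<forall>x. x = x v* M \<longrightarrow> x = 0)"

text \<open>
  Evaluate the eigenvalue equation at an entry of the eigenvector with maximal modulus. The bound
  makes the supremum in the spectral radius an upper bound of the moduli of the eigenvalues.
\<close>

lemma substochastic_spectrum_bound:
  assumes M: "substochastic M" and c: "c \<in> spectrum M"
  shows "cmod c \<le> 1"
proof -
  obtain v where v: "v \<noteq> 0" "map_matrix complex_of_real M *v v = c *s v"
    using c by (auto simp: spectrum_def)
  obtain i where i: "\<And>j. cmod (v $ j) \<le> cmod (v $ i)"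
    using Max_in[of "range (\<lambda>j. cmod (v $ j))"] Max_ge[of "range (\<lambda>j. cmod (v $ j))"]
    by (smt (verit) finite_imageI finite imageE image_is_empty UNIV_not_empty rangeI)
  have pos: "0 < cmod (v $ i)"
  proof (rule ccontr)
    assume "\<not> 0 < cmod (v $ i)"
    then have "v $ j = 0" for j using i[of j] by (smt (verit) norm_le_zero_iff)
    then show False using v(1) by (simp add: vec_eq_iff)
  qed
  have "cmod c * cmod (v $ i) = cmod ((c *s v) $ i)" by (simp add: norm_mult)
  also have "\<dots> = cmod (\<Sum>j\<in>UNIV. complex_of_real (M $ i $ j) * v $ j)"
    by (simp add: v(2)[symmetric] matrix_vector_mult_def map_matrix_def)
  also have "\<dots> \<le> (\<Sum>j\<in>UNIV. M $ i $ j * cmod (v $ i))"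
    using M i by (intro sum_norm_le) (auto simp: norm_mult substochastic_def intro!: mult_left_mono)
  also have "\<dots> = (\<Sum>j\<in>UNIV. M $ i $ j) * cmod (v $ i)" by (simp add: sum_distrib_right)
  also have "\<dots> \<le> 1 * cmod (v $ i)"
    using M by (intro mult_right_mono) (auto simp: substochastic_def)
  finally show ?thesis using pos by simp
qed

lemma subcritical_if_spectral_radius_less_1:
  assumes M: "substochastic M" and r: "spectral_radius M < 1"
  shows "subcritical M"
proof -
  have "x = 0" if x: "x = x v* M" for x
  proof (rule ccontr)
    assume "x \<noteq> 0"
    moreover have "transpose (mat 1 - M) *v x = 0"
    proof -
      have "x v* (mat 1 - M) = x v* mat 1 - x v* M"
        unfolding vec_eq_iff vec_mat_nth vector_minus_component right_diff_distrib sum_subtractf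
        by simp
      then show ?thesis using x by (simp add: transpose_matrix_vector)
    qed
    ultimately have "\<not> invertible (transpose (mat 1 - M))"
      by (metis invertible_left_inverse matrix_left_invertible_ker)
    then have "\<not> invertible (mat 1 - M)"
      by (metis invertible_det_nz det_transpose)
    then obtain w where w: "w \<noteq> 0" "(mat 1 - M) *v w = 0"
      by (metis invertible_left_inverse matrix_left_invertible_ker)
    have Mw: "(\<Sum>j\<in>UNIV. M $ i $ j * w $ j) = w $ i" for i
      using arg_cong[OF w(2), of "\<lambda>u. u $ i"]
      by (simp add: matrix_vector_mult_diff_rdistrib) (simp add: matrix_vector_mult_def)
    \<comment> \<open>The real fixed vector of \<open>M\<close>, read as a complex eigenvector for the eigenvalue \<open>1\<close>.\<close>
    define v :: "complex^'a" where "v = (\<chi> i. complex_of_real (w $ i))"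
    have "map_matrix complex_of_real M *v v = 1 *s v"
      by (simp add: vec_eq_iff matrix_vector_mult_def map_matrix_def v_def Mw
           flip: of_real_mult of_real_sum)
    moreover have "v \<noteq> 0" using w(1) by (simp add: vec_eq_iff v_def)
    ultimately have "1 \<in> spectrum M" by (auto simp: spectrum_def)
    then have "cmod 1 \<le> spectral_radius M"
      unfolding spectral_radius_def
      by (intro cSup_upper imageI)
         (use substochastic_spectrum_bound[OF M] in \<open>auto intro!: bdd_aboveI2\<close>)
    then show False using r by simp
  qed
  then show ?thesis using M by (simp add: subcritical_def)
qed

lemma subcritical_subinvariant:
  assumes M: "subcritical (M :: real^'n^'n)" and x: "0 \<le> x" "x \<le> x v* M"
  shows "x = 0"
proof -
  have "substochastic M" using M by (simp add: subcritical_def)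
  from mass_balance(2)[OF this this x(1) order_refl, of x] x(2)
  have "x = x v* M" by simp
  then show ?thesis using M by (simp add: subcritical_def)
qed

text \<open>
  The negative part \<open>y\<close> of \<open>x\<close> satisfies \<open>y \<le> y v* M\<close>, so it vanishes. Equivalently, the inverse of
  \<open>mat 1 - M\<close> is nonnegative.
\<close>

lemma subcritical_nonneg:
  assumes M: "subcritical (M :: real^'n^'n)" and x: "x v* M \<le> x"
  shows "0 \<le> x"
proof -
  have sM: "substochastic M" using M by (simp add: subcritical_def)
  define y :: "real^'n" where "y = sup (- x) 0"
  have "- x \<le> (- x) v* M" using x by (simp add: vec_le_iff vec_mat_nth sum_negf)
  also have "\<dots> \<le> y v* M" by (rule vec_mat_mono[OF _ sM]) (simp add: y_def)
  finally have "- x \<le> y v* M" .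
  moreover have "0 \<le> y v* M"
    using vec_mat_mono[OF _ sM, of 0 y] by (simp add: y_def)
  ultimately have "y \<le> y v* M" by (simp add: y_def)
  then have "y = 0" using subcritical_subinvariant[OF M] by (simp add: y_def)
  then show ?thesis by (metis neg_le_0_iff_le sup_ge1 y_def)
qed

lemma subcritical_comparison:
  assumes M: "subcritical (M :: real^'n^'n)" and y: "y \<le> c + y v* M" and x: "c + x v* M \<le> x"
  shows "y \<le> x"
proof -
  have "(x - y) v* M \<le> x - y"
    using x y by (auto simp: vec_le_iff vec_mat_nth left_diff_distrib sum_subtractf) (smt (verit))
  from subcritical_nonneg[OF M this] show ?thesis by simp
qed

lemma subcritical_mono:
  assumes M: "subcritical (M :: real^'n^'n)" and M': "\<And>i j. 0 \<le> M' $ i $ j" "\<And>i j. M' $ i $ j \<le> M $ i $ j"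
  shows "subcritical M'"
proof -
  have "x = 0" if x: "x = x v* M'" for x
  proof -
    have "\<bar>x $ j\<bar> \<le> (\<Sum>i\<in>UNIV. \<bar>x $ i\<bar> * M $ i $ j)" for j
    proof -
      have "\<bar>x $ j\<bar> = \<bar>\<Sum>i\<in>UNIV. x $ i * M' $ i $ j\<bar>" by (metis x vec_mat_nth)
      also have "\<dots> \<le> (\<Sum>i\<in>UNIV. \<bar>x $ i * M' $ i $ j\<bar>)" by (rule sum_abs)
      also have "\<dots> \<le> (\<Sum>i\<in>UNIV. \<bar>x $ i\<bar> * M $ i $ j)"
        by (intro sum_mono) (simp add: abs_mult M' mult_left_mono)
      finally show ?thesis .
    qed
    then have "(\<chi> i. \<bar>x $ i\<bar>) = 0"
      by (intro subcritical_subinvariant[OF M]) (simp_all add: vec_le_iff vec_mat_nth)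
    then show "x = 0" by (simp add: vec_eq_iff)
  qed
  then show ?thesis
    using substochastic_mono[OF _ M'] M by (simp add: subcritical_def)
qed

lemma subcritical_unique_solution:
  assumes M: "subcritical (M :: real^'n^'n)"
  shows "\<exists>!x. x = c + x v* M"
proof -
  define f where "f x = x - x v* M" for x
  have lin: "linear f"
    by (rule linearI)
       (auto simp: f_def vec_eq_iff vec_mat_nth algebra_simps sum.distrib sum_distrib_left)
  have inj: "inj f"
    unfolding linear_injective_0[OF lin] using M by (simp add: f_def subcritical_def)
  then have "surj f" using lin linear_injective_imp_surjective by blast
  then obtain x where "c = f x" by (meson surjD)
  moreover have "(y = c + y v* M) = (f y = c)" for y by (auto simp: f_def algebra_simps)
  ultimately show ?thesis using inj by (metis injD)
qed

text \<open>
  A set that keeps all its mass cannot balance a source of one unit at each of its nodes.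
\<close>

lemma subcritical_no_closed_set:
  assumes M: "subcritical (M :: real^'n^'n)" and T: "\<And>i. i \<in> T \<Longrightarrow> (\<Sum>j\<in>T. M $ i $ j) = 1"
  shows "T = {}"
proof (rule ccontr)
  assume "T \<noteq> {}"
  have sM: "substochastic M" using M by (simp add: subcritical_def)
  define b :: "real^'n" where "b = (\<chi> i. if i \<in> T then 1 else 0)"
  obtain x where x: "x = b + x v* M" using subcritical_unique_solution[OF M] by blast
  have "x v* M \<le> b + x v* M" by (simp add: b_def vec_le_iff)
  then have "x v* M \<le> x" using x by simp
  then have "0 \<le> x" by (rule subcritical_nonneg[OF M])
  then have x0: "0 \<le> x $ i" for i by (simp add: vec_le_iff)
  have "(\<Sum>j\<in>T. x $ j) = (\<Sum>j\<in>T. b $ j + (\<Sum>i\<in>UNIV. x $ i * M $ i $ j))"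
    by (metis x vector_add_component vec_mat_nth)
  also have "\<dots> = card T + (\<Sum>i\<in>UNIV. x $ i * (\<Sum>j\<in>T. M $ i $ j))"
    by (simp add: sum.distrib b_def sum.swap[of _ T] sum_distrib_left)
  also have "\<dots> \<ge> card T + (\<Sum>i\<in>T. x $ i * (\<Sum>j\<in>T. M $ i $ j))"
    using x0 sM by (intro add_left_mono sum_mono2)
      (auto simp: substochastic_def intro!: mult_nonneg_nonneg sum_nonneg)
  finally have "card T \<le> (0::real)" using T by simp
  then show False using \<open>T \<noteq> {}\<close> by (simp add: card_gt_0_iff)
qed

section \<open>The traffic equation without overflow\<close>

definition transitions :: "real^'n^'n \<Rightarrow> ('n \<times> 'n) set" where
  "transitions P = {(i, j). 0 < P $ i $ j}"

lemma mat_pow_pos_iff: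
  assumes P: "\<And>i j. 0 \<le> P $ i $ j"
  shows "0 < mat_pow P k $ i $ j \<longleftrightarrow> (i, j) \<in> transitions P ^^ k"
proof -
  have nn: "0 \<le> mat_pow P k $ i $ j" for k i j
    by (induction k arbitrary: i j)
       (auto simp: mat_def matrix_matrix_mult_def P intro!: sum_nonneg mult_nonneg_nonneg)
  show ?thesis
  proof (induction k arbitrary: i j)
    case 0
    then show ?case by (simp add: mat_def)
  next
    case (Suc k)
    have ge: "0 \<le> mat_pow P k $ i $ m * P $ m $ j" for m by (simp add: nn P)
    have "mat_pow P (Suc k) $ i $ j = 0 \<longleftrightarrow> (\<forall>m. mat_pow P k $ i $ m * P $ m $ j = 0)"
      by (simp add: matrix_matrix_mult_def sum_nonneg_eq_0_iff ge del: mult_eq_0_iff)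
    then have "0 < mat_pow P (Suc k) $ i $ j \<longleftrightarrow> (\<exists>m. 0 < mat_pow P k $ i $ m * P $ m $ j)"
      using nn[of "Suc k"] ge by (metis less_le)
    also have "\<dots> \<longleftrightarrow> (\<exists>m. 0 < mat_pow P k $ i $ m \<and> 0 < P $ m $ j)"
      using P nn by (metis mult_pos_pos order_less_le mult_zero_left mult_zero_right)
    finally show ?case by (auto simp: Suc.IH transitions_def)
  qed
qed

text \<open>
  A node of \<open>T\<close> from which as few nodes as possible can be reached communicates with all of them.
  Its class is thus exactly what it reaches; it lies in \<open>T\<close> and cannot be drained, so it can be
  filled.
\<close>

lemma NI_closed_set_filled:
  assumes NI: "NI \<alpha> P" and P: "\<And>i j. 0 \<le> P $ i $ j"
    and T: "T \<noteq> {}" "\<And>i. i \<in> T \<Longrightarrow> (\<Sum>j\<in>UNIV. P $ i $ j) = 1"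
      "\<And>i j. i \<in> T \<Longrightarrow> j \<notin> T \<Longrightarrow> P $ i $ j = 0"
  shows "\<exists>i. \<exists>j\<in>T. 0 < \<alpha> $ i \<and> (i, j) \<in> (transitions P)\<^sup>*"
proof -
  let ?E = "transitions P"
  define R where "R i = ?E\<^sup>* `` {i}" for i
  obtain i where i: "i \<in> T" and min: "\<And>j. j \<in> T \<Longrightarrow> card (R i) \<le> card (R j)"
    using T(1) by (metis ex_in_conv ex_has_least_nat[of "\<lambda>i. i \<in> T" _ "\<lambda>i. card (R i)"])
  have stay: "j \<in> T" if "k \<in> T" "0 < P $ k $ j" for k j using T(3)[of k j] that by force
  have RT: "R i \<subseteq> T"
  proof
    fix j assume "j \<in> R i"
    then have "(i, j) \<in> ?E\<^sup>*" by (simp add: R_def)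
    then show "j \<in> T"
      by (induction rule: rtrancl_induct) (use i stay in \<open>auto simp: transitions_def\<close>)
  qed
  have backward: "(j, i) \<in> ?E\<^sup>*" if j: "j \<in> R i" for j
  proof -
    have "R j \<subseteq> R i" using j by (auto simp: R_def)
    moreover have "card (R i) \<le> card (R j)" using j RT min by blast
    ultimately have "R j = R i" by (simp add: card_subset_eq card_mono le_antisym)
    then show ?thesis by (auto simp: R_def)
  qed
  have "communicating P `` {i} = R i"
    using backward by (auto simp: communicating_def R_def mat_pow_pos_iff[OF P] rtrancl_power)
  then have "R i \<in> classes P" unfolding classes_def by (metis UNIV_I quotientI)
  then have "can_be_filled \<alpha> P (R i) \<or> can_be_drained P (R i)"
    using NI by (auto simp: NI_def isolated_class_def)
  moreover have "\<not> can_be_drained P (R i)"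
  proof
    assume "can_be_drained P (R i)"
    then obtain k j where "k \<in> R i" "j \<notin> R i" "0 < P $ k $ j"
      using RT T(2) by (fastforce simp: can_be_drained_def)
    then show False by (auto simp: R_def transitions_def dest: rtrancl_into_rtrancl)
  qed
  ultimately have "\<exists>k. \<exists>j\<in>R i. 0 < \<alpha> $ k \<and> (k, j) \<in> ?E\<^sup>*"
    by (auto simp: can_be_filled_def mat_pow_pos_iff[OF P] rtrancl_power)
       (metis relpow_0_I)
  then show ?thesis using RT by blast
qed

text \<open>
  On \<open>T = {i. z $ i < w $ i}\<close> no mass is lost: \<open>T\<close> is closed and stochastic, and \<open>w\<close> does not exceed
  \<open>\<mu>\<close> there. The balance of \<open>w\<close> on \<open>T\<close> then leaves no room for any inflow from outside \<open>T\<close>, whereas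
  the NI condition provides a path from a source into \<open>T\<close>, along which \<open>w\<close> is positive.
\<close>

lemma NI_comparison:
  assumes net: "network \<alpha> \<mu> P Q" and NI: "NI \<alpha> P"
    and w: "0 \<le> w" "w = \<alpha> + inf w \<mu> v* P" and z: "\<alpha> + inf z \<mu> v* P \<le> z"
  shows "w \<le> z"
proof (rule ccontr)
  assume "\<not> w \<le> z"
  have sP: "substochastic P" and \<alpha>: "0 \<le> \<alpha> $ i" and \<mu>: "0 < \<mu> $ i" for i
    using net by (auto simp: network_def vec_le_iff)
  have P0: "0 \<le> P $ i $ j" for i j using sP by (simp add: substochastic_def)
  define d a where "d = sup (w - z) 0" and "a = sup (inf w \<mu> - inf z \<mu>) 0"
  define T where "T = {i. 0 < d $ i}"
  have "w - z \<le> (inf w \<mu> - inf z \<mu>) v* P"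
    using w(2) z by (auto simp: vec_le_iff vec_mat_nth left_diff_distrib sum_subtractf vec_eq_iff)
      (smt (verit))
  also have "\<dots> \<le> a v* P" by (rule vec_mat_mono[OF _ sP]) (simp add: a_def)
  finally have "d \<le> a v* P" using vec_mat_mono[OF _ sP, of 0 a] by (simp add: d_def a_def)
  moreover have "a \<le> d" by (auto simp: vec_le_iff a_def d_def sup_vec_nth inf_vec_nth)
  ultimately have bal: "d = a" "\<And>i. 0 < a $ i \<Longrightarrow> (\<Sum>j\<in>UNIV. P $ i $ j) = 1"
      "\<And>i j. d $ j = 0 \<Longrightarrow> 0 < a $ i \<Longrightarrow> P $ i $ j = 0"
    using mass_balance[OF sP sP, of a 0 d] by (simp_all add: a_def)
  have T0: "T \<noteq> {}"
    using \<open>\<not> w \<le> z\<close> by (auto simp: T_def d_def vec_le_iff sup_vec_nth not_le less_max_iff_disj)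
  have d0: "d $ j = 0" if "j \<notin> T" for j
    using that by (auto simp: T_def d_def sup_vec_nth)
  have Trow: "(\<Sum>j\<in>UNIV. P $ i $ j) = 1" if "i \<in> T" for i using that bal by (simp add: T_def)
  have Tclosed: "P $ i $ j = 0" if "i \<in> T" "j \<notin> T" for i j
    using that bal(1) bal(3)[OF d0] by (simp add: T_def)
  have Trow': "(\<Sum>j\<in>T. P $ i $ j) = 1" if "i \<in> T" for i
    using Trow[OF that] Tclosed[OF that] sum.mono_neutral_right[of UNIV T "\<lambda>j. P $ i $ j"] by simp
  have wT: "inf w \<mu> $ i = w $ i" if "i \<in> T" for i
  proof -
    have "d $ i = a $ i" "0 < d $ i" using bal(1) that by (simp_all add: T_def)
    then show ?thesis unfolding d_def a_def by (auto simp: sup_vec_nth inf_vec_nth max_def min_def split: if_splits)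
  qed
  have w0: "0 \<le> inf w \<mu> $ i" for i
    using w(1) \<mu>[of i] by (auto simp: inf_vec_nth vec_le_iff)
  have wj: "w $ j = \<alpha> $ j + (\<Sum>i\<in>UNIV. inf w \<mu> $ i * P $ i $ j)" for j
    using w(2) by (metis vector_add_component vec_mat_nth)
  \<comment> \<open>Balance over \<open>T\<close>: the outflow of \<open>T\<close> into itself already accounts for all of \<open>w\<close> on \<open>T\<close>.\<close>
  have "(\<Sum>j\<in>T. w $ j) = (\<Sum>j\<in>T. \<alpha> $ j) + (\<Sum>i\<in>UNIV. inf w \<mu> $ i * (\<Sum>j\<in>T. P $ i $ j))"
    by (subst wj) (simp add: sum.distrib sum.swap[of _ T] sum_distrib_left)
  also have "(\<Sum>i\<in>UNIV. inf w \<mu> $ i * (\<Sum>j\<in>T. P $ i $ j)) =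
      (\<Sum>i\<in>-T. inf w \<mu> $ i * (\<Sum>j\<in>T. P $ i $ j)) + (\<Sum>i\<in>T. w $ i)"
    by (subst sum.subset_diff[of T]) (auto simp: Compl_eq_Diff_UNIV wT Trow')
  finally have "(\<Sum>j\<in>T. \<alpha> $ j) + (\<Sum>i\<in>-T. inf w \<mu> $ i * (\<Sum>j\<in>T. P $ i $ j)) = 0" by simp
  moreover have "0 \<le> (\<Sum>j\<in>T. \<alpha> $ j)" using \<alpha> by (simp add: sum_nonneg)
  moreover have nn: "0 \<le> inf w \<mu> $ i * (\<Sum>j\<in>T. P $ i $ j)" for i
    using w0 P0 by (simp add: sum_nonneg)
  then have "0 \<le> (\<Sum>i\<in>-T. inf w \<mu> $ i * (\<Sum>j\<in>T. P $ i $ j))" by (intro sum_nonneg)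
  ultimately have "(\<Sum>j\<in>T. \<alpha> $ j) = 0"
    and "(\<Sum>i\<in>-T. inf w \<mu> $ i * (\<Sum>j\<in>T. P $ i $ j)) = 0" by linarith+
  then have \<alpha>T: "\<And>j. j \<in> T \<Longrightarrow> \<alpha> $ j = 0"
    and "\<And>i. i \<in> -T \<Longrightarrow> inf w \<mu> $ i * (\<Sum>j\<in>T. P $ i $ j) = 0"
    using \<alpha> nn by (simp_all add: sum_nonneg_eq_0_iff del: mult_eq_0_iff)
  then have inflow: "P $ i $ j = 0" if "i \<notin> T" "j \<in> T" "0 < w $ i" for i j
    using that \<mu>[of i] P0 by (force simp: inf_vec_nth sum_nonneg_eq_0_iff min_def split: if_splits)
  obtain k j where kj: "0 < \<alpha> $ k" "(k, j) \<in> (transitions P)\<^sup>*" "j \<in> T"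
    using NI_closed_set_filled[OF NI P0 T0 Trow Tclosed] by blast
  \<comment> \<open>Positive flow spreads along the path, but it can never enter \<open>T\<close>.\<close>
  from kj(2) have "0 < w $ j \<and> j \<notin> T"
  proof (induction rule: rtrancl_induct)
    case base
    have "0 \<le> (\<Sum>i\<in>UNIV. inf w \<mu> $ i * P $ i $ k)" using w0 P0 by (simp add: sum_nonneg)
    then show ?case using kj(1) wj[of k] \<alpha>T[of k] by auto
  next
    case (step i j)
    then have p: "0 < P $ i $ j" by (simp add: transitions_def)
    have "inf w \<mu> $ i * P $ i $ j \<le> (\<Sum>i\<in>UNIV. inf w \<mu> $ i * P $ i $ j)"
      using w0 P0 by (intro member_le_sum) auto
    moreover have "0 < inf w \<mu> $ i * P $ i $ j" using p step.IH \<mu>[of i] by (simp add: inf_vec_nth)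
    ultimately have "0 < w $ j" using wj[of j] \<alpha>[of j] by linarith
    then show ?case using p step.IH inflow[of i j] by auto
  qed
  then show False using kj(3) by blast
qed

text \<open>
  The right-hand side maps the box between \<open>0\<close> and \<open>\<alpha> + \<mu> v* P\<close> continuously into itself.
\<close>

lemma traffic_eq_exists:
  assumes net: "network \<alpha> \<mu> P Q"
  shows "\<exists>w\<ge>0. w = \<alpha> + inf w \<mu> v* P"
proof -
  have sP: "substochastic P" and \<alpha>: "0 \<le> \<alpha>" and \<mu>: "0 \<le> \<mu>"
    using net by (auto simp: network_def vec_le_iff less_imp_le)
  define f where "f w = \<alpha> + inf w \<mu> v* P" for w
  define u where "u = \<alpha> + \<mu> v* P"
  have f: "f w \<in> {0..u}" if "w \<in> {0..u}" for w
  proof -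
    have "0 v* P \<le> inf w \<mu> v* P" using that \<mu> by (intro vec_mat_mono sP) auto
    moreover have "inf w \<mu> v* P \<le> \<mu> v* P" by (intro vec_mat_mono sP) auto
    ultimately show ?thesis using \<alpha> by (auto simp: f_def u_def intro: add_nonneg_nonneg)
  qed
  have "0 \<le> u"
    using \<alpha> vec_mat_mono[OF \<mu> sP] by (simp add: u_def)
  then have ne: "{0..u} \<noteq> {}" by auto
  have "continuous_on {0..u} f"
    unfolding f_def vector_matrix_mult_def inf_vec_def inf_real_def
    by (intro continuous_intros)
  then obtain w where "w \<in> {0..u}" "f w = w"
    using brouwer[of "{0..u}" f] f ne by (auto simp: interval_cbox_cart compact_cbox convex_box)
  then have "0 \<le> w" "w = f w" by simp_all
  then show ?thesis unfolding f_def by blast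
qed

lemma lambda_star_solution:
  assumes net: "network \<alpha> \<mu> P Q" and NI: "NI \<alpha> P"
  shows "0 \<le> lambda_star \<alpha> \<mu> P"
    and "lambda_star \<alpha> \<mu> P = \<alpha> + inf (lambda_star \<alpha> \<mu> P) \<mu> v* P"
proof -
  obtain w where w: "0 \<le> w" "w = \<alpha> + inf w \<mu> v* P" using traffic_eq_exists[OF net] by blast
  have "lambda_star \<alpha> \<mu> P = w"
    unfolding lambda_star_def
  proof (rule the_equality)
    show "w = \<alpha> + inf w \<mu> v* P" by (rule w(2))
    fix z assume z: "z = \<alpha> + inf z \<mu> v* P"
    have "w \<le> z" by (rule NI_comparison[OF net NI w]) (metis z order_refl)
    moreover have "z \<le> w"
      using NI_comparison[OF net NI _ z, of w] w \<open>w \<le> z\<close> by (metis order_refl order_trans)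
    ultimately show "z = w" by simp
  qed
  then show "0 \<le> lambda_star \<alpha> \<mu> P"
    and "lambda_star \<alpha> \<mu> P = \<alpha> + inf (lambda_star \<alpha> \<mu> P) \<mu> v* P" using w by simp_all
qed

section \<open>Uniqueness for the overflow equation\<close>

lemma overflow_condition_subcritical:
  assumes net: "network \<alpha> \<mu> P Q" and oc: "overflow_condition \<alpha> \<mu> P Q"
    and A: "A \<subseteq> - overflow_set \<mu> (lambda_star \<alpha> \<mu> P)"
  shows "subcritical (restrict_rows P A + restrict_rows Q (- A))"
  using assms unfolding overflow_condition_def network_def
  by (intro subcritical_if_spectral_radius_less_1 substochastic_row_mixture) auto

text \<open>
  Overflow only adds flow, so a solution with overflow is a supersolution of the equation
  without it.
\<close>

lemma overflow_traffic_eq_lower_bound: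
  assumes net: "network \<alpha> \<mu> P Q" and NI: "NI \<alpha> P" and x: "overflow_traffic_eq \<alpha> \<mu> P Q x"
  shows "lambda_star \<alpha> \<mu> P \<le> x"
proof (rule NI_comparison[OF net NI lambda_star_solution[OF net NI]])
  have "0 v* Q \<le> sup (x - \<mu>) 0 v* Q"
    using net by (intro vec_mat_mono) (auto simp: network_def)
  then have "\<alpha> + inf x \<mu> v* P \<le> \<alpha> + inf x \<mu> v* P + sup (x - \<mu>) 0 v* Q" by simp
  then show "\<alpha> + inf x \<mu> v* P \<le> x" using x by (metis overflow_traffic_eq_def)
qed

text \<open>
  A node that is below capacity in one solution and above it in the other contributes to the
  difference through \<open>P\<close> and through \<open>Q\<close>, that is, through a mixture of the two rows, while the
  overflow condition allows only a choice between them. This is no obstacle: where mass is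
  conserved, both rows are stochastic and stay in the support \<open>T\<close>, so either may be chosen.
\<close>

lemma overflow_traffic_eq_unique:
  fixes \<alpha> \<mu> x y :: "real^'n"
  assumes net: "network \<alpha> \<mu> P Q" and oc: "overflow_condition \<alpha> \<mu> P Q"
    and x: "overflow_traffic_eq \<alpha> \<mu> P Q x" and y: "overflow_traffic_eq \<alpha> \<mu> P Q y"
  shows "x = y"
proof -
  have sP: "substochastic P" and sQ: "substochastic Q"
    using net by (auto simp: network_def)
  have NI: "NI \<alpha> P" using oc by (simp add: overflow_condition_def)
  note lower = overflow_traffic_eq_lower_bound[OF net NI]
  define d a b :: "real^'n" where "d = (\<chi> i. \<bar>x $ i - y $ i\<bar>)"
    and "a = (\<chi> i. \<bar>inf x \<mu> $ i - inf y \<mu> $ i\<bar>)"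
    and "b = (\<chi> i. \<bar>sup (x - \<mu>) 0 $ i - sup (y - \<mu>) 0 $ i\<bar>)"
  \<comment> \<open>At nodes of \<open>T - A\<close> the difference is pure overflow, so there the row of \<open>Q\<close> is the right choice.\<close>
  define A T where "A = {i. 0 < a $ i}" and "T = {i. 0 < d $ i}"
  have a0: "0 \<le> a" and b0: "0 \<le> b" by (simp_all add: a_def b_def vec_le_iff)
  have dab: "d = a + b"
    by (auto simp: vec_eq_iff d_def a_def b_def inf_vec_nth sup_vec_nth)
  have "d \<le> a v* P + b v* Q"
    unfolding vec_le_iff
  proof
    fix j
    have eq: "u $ j = \<alpha> $ j + (\<Sum>i\<in>UNIV. inf u \<mu> $ i * P $ i $ j) + (\<Sum>i\<in>UNIV. sup (u - \<mu>) 0 $ i * Q $ i $ j)"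
      if "overflow_traffic_eq \<alpha> \<mu> P Q u" for u
      using arg_cong[OF that[unfolded overflow_traffic_eq_def], of "\<lambda>v. v $ j"]
      by (simp only: vector_add_component vec_mat_nth)
    have "d $ j = \<bar>(\<Sum>i\<in>UNIV. (inf x \<mu> $ i - inf y \<mu> $ i) * P $ i $ j) +
        (\<Sum>i\<in>UNIV. (sup (x - \<mu>) 0 $ i - sup (y - \<mu>) 0 $ i) * Q $ i $ j)\<bar>"
      using eq[OF x] eq[OF y] by (simp add: d_def left_diff_distrib sum_subtractf)
    also have "\<dots> \<le> (\<Sum>i\<in>UNIV. \<bar>(inf x \<mu> $ i - inf y \<mu> $ i) * P $ i $ j\<bar>) +
        (\<Sum>i\<in>UNIV. \<bar>(sup (x - \<mu>) 0 $ i - sup (y - \<mu>) 0 $ i) * Q $ i $ j\<bar>)"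
      by (intro order_trans[OF abs_triangle_ineq] add_mono sum_abs)
    also have "\<dots> = (a v* P + b v* Q) $ j"
    proof -
      have "\<bar>P $ i $ j\<bar> = P $ i $ j" "\<bar>Q $ i $ j\<bar> = Q $ i $ j" for i
        using sP sQ by (simp_all add: substochastic_def)
      then show ?thesis
        by (simp only: vec_mat_nth a_def b_def abs_mult vector_add_component vec_lambda_beta)
    qed
    finally show "d $ j \<le> (a v* P + b v* Q) $ j" .
  qed
  note bal = mass_balance(3-6)[OF sP sQ a0 b0 eq_refl[OF dab[symmetric]] this]
  have A: "A \<subseteq> - overflow_set \<mu> (lambda_star \<alpha> \<mu> P)"
  proof
    fix i assume "i \<in> A"
    then have "x $ i < \<mu> $ i \<or> y $ i < \<mu> $ i" by (auto simp: A_def a_def inf_vec_nth)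
    then show "i \<in> - overflow_set \<mu> (lambda_star \<alpha> \<mu> P)"
      using lower[OF x] lower[OF y] by (auto simp: overflow_set_def vec_le_iff) (meson leD order_trans)+
  qed
  let ?M = "restrict_rows P A + restrict_rows Q (- A)"
  have "(\<Sum>j\<in>T. ?M $ i $ j) = 1" if i: "i \<in> T" for i
  proof -
    have d0: "d $ j = 0" if "j \<notin> T" for j using that by (auto simp: T_def d_def)
    have 1: "(\<Sum>j\<in>UNIV. ?M $ i $ j) = 1 \<and> (\<forall>j. j \<notin> T \<longrightarrow> ?M $ i $ j = 0)"
    proof (cases "i \<in> A")
      case True
      then show ?thesis using bal(1)[of i] bal(3)[of _ i] d0 by (simp add: A_def restrict_rows_def)
    next
      case False
      moreover have "0 < b $ i"
        using i False by (simp add: T_def A_def dab)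
      ultimately show ?thesis using bal(2)[of i] bal(4)[of _ i] d0 by (simp add: restrict_rows_def)
    qed
    then show ?thesis
      using sum.mono_neutral_right[of UNIV T "\<lambda>j. ?M $ i $ j"] by simp
  qed
  then have "T = {}"
    by (rule subcritical_no_closed_set[OF overflow_condition_subcritical[OF net oc A]])
  then show ?thesis by (simp add: T_def d_def vec_eq_iff)
qed

section \<open>Monotonicity of the algorithm\<close>

lemma iteration_eq_affine:
  "iteration_eq \<alpha> \<mu> P Q B S x \<longleftrightarrow>
     x = (\<alpha> + \<mu> v* restrict_rows P (- S) - \<mu> v* restrict_rows Q B)
         + x v* (restrict_rows P S + restrict_rows Q B)"
proof -
  have "(x - \<mu>) v* restrict_rows Q B = x v* restrict_rows Q B - \<mu> v* restrict_rows Q B"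
    by (simp add: vec_eq_iff vec_mat_nth left_diff_distrib sum_subtractf)
  moreover have "x v* (restrict_rows P S + restrict_rows Q B) =
      x v* restrict_rows P S + x v* restrict_rows Q B"
    by (simp add: vec_eq_iff vec_mat_nth distrib_left sum.distrib)
  ultimately show ?thesis unfolding iteration_eq_def by (simp add: algebra_simps)
qed

lemma split_rows:
  "v v* restrict_rows P (- S) + w v* restrict_rows P S = (\<chi> i. if i \<in> S then w $ i else v $ i) v* P"
  by (simp add: vec_eq_iff vec_mat_nth restrict_rows_def sum.distrib[symmetric] if_distrib cong: if_cong)
     (auto intro!: sum.cong)

text \<open>
  The vector \<open>y\<close> stands for the result of the previous pass (at the start, for \<open>\<lambda>\<^sup>*\<close>). It is a
  subsolution for every linear equation of the current pass and thereby a lower bound for all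
  iterates, which keeps the nodes of \<open>B\<close> at or above capacity. The last conjunct says that the
  next inner iteration removes nothing from \<open>S\<close>.
\<close>

definition loop_invariant ::
    "real^'n \<Rightarrow> real^'n \<Rightarrow> real^'n^'n \<Rightarrow> real^'n^'n \<Rightarrow> 'n set \<Rightarrow> 'n set \<Rightarrow> bool" where
  "loop_invariant \<alpha> \<mu> P Q B S \<longleftrightarrow>
     S \<subseteq> - B \<and> S \<subseteq> - overflow_set \<mu> (lambda_star \<alpha> \<mu> P) \<and>
     (\<exists>y. lambda_star \<alpha> \<mu> P \<le> y \<and> (\<forall>i\<in>B. \<mu> $ i \<le> y $ i) \<and>
          y \<le> \<alpha> + inf y \<mu> v* P + (y - \<mu>) v* restrict_rows Q B) \<and>
     (\<forall>x. iteration_eq \<alpha> \<mu> P Q B S x \<longrightarrow> (\<forall>i\<in>S. x $ i < \<mu> $ i))"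

text \<open>
  As \<open>S\<close> and \<open>B\<close> are disjoint, the matrix is dominated by the one that the overflow condition
  provides for \<open>A = S\<close>.
\<close>

lemma iteration_matrix_subcritical:
  assumes net: "network \<alpha> \<mu> P Q" and oc: "overflow_condition \<alpha> \<mu> P Q"
    and S: "S \<subseteq> - B" "S \<subseteq> - overflow_set \<mu> (lambda_star \<alpha> \<mu> P)"
  shows "subcritical (restrict_rows P S + restrict_rows Q B)"
  by (rule subcritical_mono[OF overflow_condition_subcritical[OF net oc S(2)]])
     (use net S(1) in \<open>auto simp: network_def substochastic_def restrict_rows_def\<close>)

text \<open>
  Replacing \<open>inf y \<mu>\<close> by \<open>y\<close> on \<open>S\<close> and by \<open>\<mu>\<close> elsewhere only increases the right-hand side, so \<open>y\<close>
  is a subsolution of the linear equation.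
\<close>

lemma iteration_eq_lower_bound:
  assumes net: "network \<alpha> \<mu> P Q" and oc: "overflow_condition \<alpha> \<mu> P Q"
    and S: "S \<subseteq> - B" "S \<subseteq> - overflow_set \<mu> (lambda_star \<alpha> \<mu> P)"
    and y: "y \<le> \<alpha> + inf y \<mu> v* P + (y - \<mu>) v* restrict_rows Q B"
    and x: "iteration_eq \<alpha> \<mu> P Q B S x"
  shows "y \<le> x"
proof -
  have sP: "substochastic P" using net by (simp add: network_def)
  have "inf y \<mu> v* P \<le> \<mu> v* restrict_rows P (- S) + y v* restrict_rows P S"
    unfolding split_rows by (rule vec_mat_mono[OF _ sP]) (simp add: vec_le_iff inf_vec_nth)
  then have "y \<le> \<alpha> + (\<mu> v* restrict_rows P (- S) + y v* restrict_rows P S)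
      + (y - \<mu>) v* restrict_rows Q B"
    using y by (meson add_left_mono add_right_mono order_trans)
  also have "\<dots> = (\<alpha> + \<mu> v* restrict_rows P (- S) - \<mu> v* restrict_rows Q B)
         + y v* (restrict_rows P S + restrict_rows Q B)"
    by (simp add: vec_eq_iff vec_mat_nth algebra_simps sum.distrib sum_subtractf)
  finally show ?thesis
    by (rule subcritical_comparison[OF iteration_matrix_subcritical[OF net oc S]])
      (metis x iteration_eq_affine order_refl)
qed

lemma iteration_eq_unique:
  assumes "network \<alpha> \<mu> P Q" "overflow_condition \<alpha> \<mu> P Q" "loop_invariant \<alpha> \<mu> P Q B S"
  shows "\<exists>!x. iteration_eq \<alpha> \<mu> P Q B S x"
  unfolding iteration_eq_affine
  by (rule subcritical_unique_solution, rule iteration_matrix_subcritical)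
     (use assms in \<open>auto simp: loop_invariant_def\<close>)

lemma loop_invariant_solution:
  assumes net: "network \<alpha> \<mu> P Q" and oc: "overflow_condition \<alpha> \<mu> P Q"
    and inv: "loop_invariant \<alpha> \<mu> P Q B S" and x: "iteration_eq \<alpha> \<mu> P Q B S x"
  shows "B \<subseteq> overflow_set \<mu> x" and "S \<subseteq> - overflow_set \<mu> x" and "lambda_star \<alpha> \<mu> P \<le> x"
proof -
  obtain y where y: "lambda_star \<alpha> \<mu> P \<le> y" "\<forall>i\<in>B. \<mu> $ i \<le> y $ i"
      "y \<le> \<alpha> + inf y \<mu> v* P + (y - \<mu>) v* restrict_rows Q B"
    and S: "S \<subseteq> - B" "S \<subseteq> - overflow_set \<mu> (lambda_star \<alpha> \<mu> P)"
    using inv unfolding loop_invariant_def by blast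
  have yx: "y \<le> x" using iteration_eq_lower_bound[OF net oc S y(3) x] .
  then show "lambda_star \<alpha> \<mu> P \<le> x" using y(1) by simp
  show "B \<subseteq> overflow_set \<mu> x"
    using yx y(2) by (auto simp: overflow_set_def vec_le_iff intro: order_trans)
  show "S \<subseteq> - overflow_set \<mu> x"
    using inv x by (force simp: loop_invariant_def overflow_set_def)
qed

text \<open>
  The nodes that join \<open>S\<close> now emit \<open>x $ i\<close> instead of the larger \<open>\<mu> $ i\<close>, so the current solution \<open>x\<close> is
  a supersolution of the next equation, and the next solution stays below capacity on \<open>S'\<close>.
\<close>

lemma loop_invariant_inner:
  assumes net: "network \<alpha> \<mu> P Q" and oc: "overflow_condition \<alpha> \<mu> P Q"
    and inv: "loop_invariant \<alpha> \<mu> P Q B S" and x: "iteration_eq \<alpha> \<mu> P Q B S x"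
    and S': "S' = {i. i \<notin> B \<and> x $ i < \<mu> $ i}"
  shows "loop_invariant \<alpha> \<mu> P Q B S'" and "S \<subseteq> S'"
proof -
  note sol = loop_invariant_solution[OF net oc inv x]
  show SS': "S \<subseteq> S'"
    using sol(2) inv by (auto simp: S' loop_invariant_def overflow_set_def)
  have S'B: "S' \<subseteq> - B" by (auto simp: S')
  have S'U: "S' \<subseteq> - overflow_set \<mu> (lambda_star \<alpha> \<mu> P)"
    using sol(3) by (auto simp: S' overflow_set_def vec_le_iff) (meson leD order_trans)
  have sP: "substochastic P" using net by (simp add: network_def)
  have "\<mu> v* restrict_rows P (- S') + x v* restrict_rows P S'
      \<le> \<mu> v* restrict_rows P (- S) + x v* restrict_rows P S"
    unfolding split_rows using SS' by (intro vec_mat_mono[OF _ sP]) (auto simp: vec_le_iff S')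
  then have "\<alpha> + (\<mu> v* restrict_rows P (- S') + x v* restrict_rows P S') + (x - \<mu>) v* restrict_rows Q B
      \<le> \<alpha> + (\<mu> v* restrict_rows P (- S) + x v* restrict_rows P S) + (x - \<mu>) v* restrict_rows Q B"
    by (intro add_left_mono add_right_mono)
  also have "\<dots> = x" using x[unfolded iteration_eq_def, symmetric] by (simp only: add.assoc)
  finally have super: "(\<alpha> + \<mu> v* restrict_rows P (- S') - \<mu> v* restrict_rows Q B)
         + x v* (restrict_rows P S' + restrict_rows Q B) \<le> x"
    by (simp add: vec_le_iff vec_mat_nth algebra_simps sum.distrib sum_subtractf)
  have "x' \<le> x" if x': "iteration_eq \<alpha> \<mu> P Q B S' x'" for x'
    by (rule subcritical_comparison[OF iteration_matrix_subcritical[OF net oc S'B S'U] _ super])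
       (metis x' iteration_eq_affine order_refl)
  then have "\<forall>x'. iteration_eq \<alpha> \<mu> P Q B S' x' \<longrightarrow> (\<forall>i\<in>S'. x' $ i < \<mu> $ i)"
    by (auto simp: S' vec_le_iff intro: le_less_trans)
  then show "loop_invariant \<alpha> \<mu> P Q B S'"
    using inv S'B S'U unfolding loop_invariant_def by blast
qed

text \<open>
  When the inner loop stops, the nodes outside \<open>S\<close> are exactly those at or above capacity, so the
  linear equation agrees with the nonlinear one except that overflow is routed from \<open>B\<close> only.
\<close>

lemma inner_loop_fixpoint:
  assumes net: "network \<alpha> \<mu> P Q" and oc: "overflow_condition \<alpha> \<mu> P Q"
    and inv: "loop_invariant \<alpha> \<mu> P Q B S" and x: "iteration_eq \<alpha> \<mu> P Q B S x"
    and S: "{i. i \<notin> B \<and> x $ i < \<mu> $ i} = S"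
  shows "S = - overflow_set \<mu> x"
    and "x = \<alpha> + inf x \<mu> v* P + (x - \<mu>) v* restrict_rows Q B"
proof -
  show SU: "S = - overflow_set \<mu> x"
    using loop_invariant_solution(1)[OF net oc inv x] S by (fastforce simp: overflow_set_def)
  have "(\<chi> i. if i \<in> S then x $ i else \<mu> $ i) = inf x \<mu>"
    by (auto simp: vec_eq_iff inf_vec_nth SU overflow_set_def)
  then have "\<mu> v* restrict_rows P (- S) + x v* restrict_rows P S = inf x \<mu> v* P"
    by (simp add: split_rows)
  then show "x = \<alpha> + inf x \<mu> v* P + (x - \<mu>) v* restrict_rows Q B"
    using x unfolding iteration_eq_def by (metis add.assoc)
qed

lemma overflow_excess: "sup (x - \<mu>) 0 v* Q = (x - \<mu>) v* restrict_rows Q (overflow_set \<mu> x)"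
  by (auto simp: vec_eq_iff vec_mat_nth restrict_rows_def overflow_set_def sup_vec_nth intro!: sum.cong)

text \<open>
  The result \<open>x\<close> of the pass serves as the new subsolution: routing the overflow of further nodes,
  where \<open>x\<close> is at least \<open>\<mu>\<close>, can only increase the right-hand side.
\<close>

lemma loop_invariant_outer:
  assumes net: "network \<alpha> \<mu> P Q" and oc: "overflow_condition \<alpha> \<mu> P Q"
    and inv: "loop_invariant \<alpha> \<mu> P Q B S" and x: "iteration_eq \<alpha> \<mu> P Q B S x"
    and S: "{i. i \<notin> B \<and> x $ i < \<mu> $ i} = S"
  shows "loop_invariant \<alpha> \<mu> P Q (overflow_set \<mu> x) {}"
proof -
  have Q0: "0 \<le> Q $ i $ j" for i j using net by (simp add: network_def substochastic_def)
  have "(x - \<mu>) v* restrict_rows Q B \<le> (x - \<mu>) v* restrict_rows Q (overflow_set \<mu> x)"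
    unfolding vec_le_iff vec_mat_nth_restrict
    using loop_invariant_solution(1)[OF net oc inv x] Q0
    by (intro allI sum_mono2) (auto simp: overflow_set_def)
  then have "x \<le> \<alpha> + inf x \<mu> v* P + (x - \<mu>) v* restrict_rows Q (overflow_set \<mu> x)"
    using inner_loop_fixpoint(2)[OF net oc inv x S] by (metis add_left_mono)
  then show ?thesis
    using loop_invariant_solution(3)[OF net oc inv x]
    by (auto simp: loop_invariant_def overflow_set_def intro!: exI[of _ x])
qed

lemma loop_invariant_initial:
  assumes "network \<alpha> \<mu> P Q" "overflow_condition \<alpha> \<mu> P Q"
  shows "loop_invariant \<alpha> \<mu> P Q {} {}"
proof -
  have "lambda_star \<alpha> \<mu> P = \<alpha> + inf (lambda_star \<alpha> \<mu> P) \<mu> v* P"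
    using assms lambda_star_solution(2) by (auto simp: overflow_condition_def)
  moreover have "y v* restrict_rows Q {} = 0" for y
    by (simp add: vec_eq_iff vec_mat_nth_restrict)
  ultimately show ?thesis
    by (auto simp: loop_invariant_def intro!: exI[of _ "lambda_star \<alpha> \<mu> P"])
qed

section \<open>Counting iterations\<close>

text \<open>
  The bound on the iterations left when \<open>B\<close> and \<open>S\<close> are current. With \<open>r = card (- B)\<close> it allows
  \<open>r - card S + 1\<close> iterations, as if the current pass were to fill up \<open>- B\<close>, and
  \<open>0 + 1 + \<dots> + (r - 1)\<close> for the passes that follow when it does not. It decreases with every
  transition and takes the value \<open>n (n + 1) / 2 + 1\<close> at the start.
\<close>

definition iteration_bound :: "'n::finite set \<Rightarrow> 'n set \<Rightarrow> nat" where
  "iteration_bound B S = card (- B) - card S + \<Sum>{..<card (- B)} + 1"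

lemma iteration_bound_inner:
  assumes "S \<subset> S'" "S' \<subseteq> - B"
  shows "iteration_bound B S' < iteration_bound B S"
proof -
  have "card S < card S'" "card S' \<le> card (- B)"
    using assms by (auto intro: psubset_card_mono card_mono)
  then show ?thesis by (simp add: iteration_bound_def)
qed

text \<open>
  A pass that ends with \<open>S = - U\<close> starts the next one with \<open>card (- U) = card S < card (- B)\<close>, so the
  sum loses at least the term \<open>card S\<close>, which pays for the inner iterations of the next pass.
\<close>

lemma iteration_bound_outer:
  assumes "S = - U" "B \<subset> U"
  shows "iteration_bound U {} < iteration_bound B S"
proof -
  have lt: "card S < card (- B)" using assms by (intro psubset_card_mono) auto
  have "card S + \<Sum>{..<card S} = \<Sum>{..<Suc (card S)}" by simp
  also have "\<dots> \<le> \<Sum>{..<card (- B)}" using lt by (intro sum_mono2) auto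
  finally show ?thesis using lt assms(1) by (simp add: iteration_bound_def)
qed

lemma iteration_bound_initial:
  "iteration_bound {} ({} :: 'n::finite set) \<le> (if CARD('n) = 1 then 2 else CARD('n)\<^sup>2)"
proof -
  have "n + \<Sum>{..<n} + 1 \<le> n\<^sup>2" if "2 \<le> n" for n :: nat
    using that by (induction n rule: nat_induct_at_least) (auto simp: power2_eq_square numeral_2_eq_2)
  moreover have "CARD('n) = 1 \<or> 2 \<le> CARD('n)" using zero_less_card_finite[where 'a = 'n] by linarith
  ultimately show ?thesis by (auto simp: iteration_bound_def)
qed

lemma algorithm_terminates:
  assumes net: "network \<alpha> \<mu> P Q" and oc: "overflow_condition \<alpha> \<mu> P Q"
    and "loop_invariant \<alpha> \<mu> P Q B S"
  shows "\<exists>x m. (iteration \<alpha> \<mu> P Q ^^ m) (Running B S) (Returned x) \<and> m \<le> iteration_bound B S \<and>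
           overflow_traffic_eq \<alpha> \<mu> P Q x"
  using assms(3)
proof (induction "iteration_bound B S" arbitrary: B S rule: less_induct)
  case less
  have continue: ?case
    if step: "iteration \<alpha> \<mu> P Q (Running B S) (Running B' S')"
      and inv': "loop_invariant \<alpha> \<mu> P Q B' S'"
      and dec: "iteration_bound B' S' < iteration_bound B S" for B' S'
  proof -
    from less.hyps[OF dec inv'] obtain x m where
      "(iteration \<alpha> \<mu> P Q ^^ m) (Running B' S') (Returned x)" "m \<le> iteration_bound B' S'"
      "overflow_traffic_eq \<alpha> \<mu> P Q x" by blast
    moreover from this(1) have "(iteration \<alpha> \<mu> P Q ^^ Suc m) (Running B S) (Returned x)"
      by (rule relpowp_Suc_I2[rotated]) (rule step)
    ultimately show ?thesis using dec by (metis Suc_leI le_less_trans)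
  qed
  obtain x where x: "iteration_eq \<alpha> \<mu> P Q B S x"
    using iteration_eq_unique[OF net oc less.prems] by blast
  define S' where "S' = {i. i \<notin> B \<and> x $ i < \<mu> $ i}"
  show ?case
  proof (cases "S' = S")
    case False
    show ?thesis
    proof (rule continue)
      show "iteration \<alpha> \<mu> P Q (Running B S) (Running B S')"
        using inner_continue[OF x S'_def False] .
      show "loop_invariant \<alpha> \<mu> P Q B S'"
        using loop_invariant_inner(1)[OF net oc less.prems x S'_def] .
      show "iteration_bound B S' < iteration_bound B S"
        using loop_invariant_inner(2)[OF net oc less.prems x S'_def] False
        by (intro iteration_bound_inner) (auto simp: S'_def)
    qed
  next
    case True
    note S = True[unfolded S'_def]
    note fp = inner_loop_fixpoint[OF net oc less.prems x S]
    show ?thesis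
    proof (cases "overflow_set \<mu> x = B")
      case False
      show ?thesis
      proof (rule continue)
        show "iteration \<alpha> \<mu> P Q (Running B S) (Running (overflow_set \<mu> x) {})"
          using outer_continue[OF x S False] .
        show "loop_invariant \<alpha> \<mu> P Q (overflow_set \<mu> x) {}"
          using loop_invariant_outer[OF net oc less.prems x S] .
        show "iteration_bound (overflow_set \<mu> x) {} < iteration_bound B S"
          using loop_invariant_solution(1)[OF net oc less.prems x] False fp(1)
          by (intro iteration_bound_outer) auto
      qed
    next
      case True
      have "overflow_traffic_eq \<alpha> \<mu> P Q x"
        unfolding overflow_traffic_eq_def overflow_excess True by (rule fp(2))
      moreover have "(iteration \<alpha> \<mu> P Q ^^ 1) (Running B S) (Returned x)"
        unfolding relpowp_1 by (rule outer_stop[OF x S True])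
      moreover have "1 \<le> iteration_bound B S" by (simp add: iteration_bound_def)
      ultimately show ?thesis by blast
    qed
  qed
qed

section \<open>Existence, uniqueness and the algorithm\<close>

lemma loop_invariant_reachable:
  assumes net: "network \<alpha> \<mu> P Q" and oc: "overflow_condition \<alpha> \<mu> P Q"
    and reach: "(iteration \<alpha> \<mu> P Q)\<^sup>*\<^sup>* initial_state (Running B S)"
  shows "loop_invariant \<alpha> \<mu> P Q B S"
proof -
  have "\<forall>B S. t = Running B S \<longrightarrow> loop_invariant \<alpha> \<mu> P Q B S"
    if "(iteration \<alpha> \<mu> P Q)\<^sup>*\<^sup>* initial_state t" for t
    using that
  proof (induction rule: rtranclp_induct)
    case base
    then show ?case using loop_invariant_initial[OF net oc] by simp
  next
    case (step s t)
    from step.hyps(2) step.IH show ?case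
      by cases (auto intro: loop_invariant_inner(1)[OF net oc] loop_invariant_outer[OF net oc])
  qed
  then show ?thesis using reach by blast
qed

theorem theorem2:
  fixes \<alpha> \<mu> :: "real^'n" and P Q :: "real^'n^'n"
  assumes "network \<alpha> \<mu> P Q"
    and "overflow_condition \<alpha> \<mu> P Q"
  shows "\<exists>x. overflow_traffic_eq \<alpha> \<mu> P Q x \<and> (\<forall>y. overflow_traffic_eq \<alpha> \<mu> P Q y \<longrightarrow> y = x) \<and> 0 \<le> x \<and>
           (\<exists>m. (iteration \<alpha> \<mu> P Q ^^ m) initial_state (Returned x) \<and>
                m \<le> (if CARD('n) = 1 then 2 else CARD('n)\<^sup>2)) \<and>
           (\<forall>B S. (iteration \<alpha> \<mu> P Q)\<^sup>*\<^sup>* initial_state (Running B S) \<longrightarrow>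
                (\<exists>!y. iteration_eq \<alpha> \<mu> P Q B S y))"
proof -
  have NI: "NI \<alpha> P" using assms(2) by (simp add: overflow_condition_def)
  obtain x m where run: "(iteration \<alpha> \<mu> P Q ^^ m) initial_state (Returned x)"
    and m: "m \<le> iteration_bound {} ({} :: 'n set)" and x: "overflow_traffic_eq \<alpha> \<mu> P Q x"
    using algorithm_terminates[OF assms loop_invariant_initial[OF assms]] by blast
  have "0 \<le> x"
    using lambda_star_solution(1)[OF assms(1) NI] overflow_traffic_eq_lower_bound[OF assms(1) NI x]
    by (rule order_trans)
  moreover have "m \<le> (if CARD('n) = 1 then 2 else CARD('n)\<^sup>2)"
    using m iteration_bound_initial by (rule order_trans)
  ultimately show ?thesis
    using x run overflow_traffic_eq_unique[OF assms _ x]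
      iteration_eq_unique[OF assms loop_invariant_reachable[OF assms]] by blast
qed

end
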